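(* Let $\rho_0,\rho_1:\mathbb{R}\to[0,\infty)$ be functions such that, for $j=0,1$: $\rho_j$ is symmetric around zero, $\rho_j(0)=0$, $\rho_j$ is continuous at zero, and there is a finite constant $c_j>0$ such that $\rho_j$ is non-decreasing on $[0,c_j]$ and constant on $[c_j,\infty)$. Suppose $\rho_1/\sup\rho_1\le \rho_0/\sup\rho_0$ pointwise and that $\rho_1$ is continuous. Let $0<b_0<\sup\rho_0$ and $r_0=b_0/\sup\rho_0$. Suppose that (a) $\theta\mapsto \mathbf V(\theta)$ is continuous on $\Theta$; (b) there is $\theta\in\Theta$ with $\mathbf V(\theta)=\mathbf I_k$, and for every $\theta\in\Theta$ and $\alpha>0$ there is $\theta'\in\Theta$ with $\alpha\mathbf V(\theta)=\mathbf V(\theta')$; (c) the pre-image under $\theta\mapsto\mathbf V(\theta)$ of every bounded set is bounded. Let $P$ be a probability measure on $\mathbb R^k\times\mathbb R^{kq}$ and suppose that for some $0<\epsilon\le 1-r_0$: (d) there is a compact set $K_\epsilon\subset\mathbb R^k\times\mathcal X$ with $P(K_\epsilon)\ge r_0+\epsilon$; (e) the value $$\delta_\epsilon=\inf\{\delta: P(H(\alpha,\ell,\delta))\ge\epsilon,\ \alpha\in\mathbb R^{k+kq},\ \|\alpha\|=1,\ \ell\in\mathbb R,\ \delta\ge0\}$$ is strictly positive (where only strips in $\mathbb R^k\times\mathcal X$ need to be considered). Let $(\beta_0(P),\theta_0(P))\in\mathbb R^q\times\Theta$ be the pair of initial functionals at $P$ and let $\sigma(P)>0$ be a solution in $\sigma$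 of $$\int\rho_0\left(\frac{\sqrt{(\mathbf y-\mathbf X\beta_0(P))^T\Gamma(\theta_0(P))^{-1}(\mathbf y-\mathbf X\beta_0(P))}}{\sigma}\right)dP(\mathbf s)=b_0 .$$ Then there exists a pair $(\beta_1(P),\gamma(P))\in\mathfrak D$ that minimizes $$R_P(\beta,\mathbf V(\gamma))=\int\rho_1\left(\frac{\sqrt{(\mathbf y-\mathbf X\beta)^T\mathbf V(\gamma)^{-1}(\mathbf y-\mathbf X\beta)}}{\sigma(P)}\right)dP(\mathbf s)$$ over $(\beta,\gamma)\in\mathfrak D$, and a vector $\theta_1(P)\in\Theta$ that is the unique solution of $\mathbf V(\theta)=\sigma^2(P)\mathbf V(\gamma(P))$.
   Context: Fix positive integers $k,q,l$. A point $\mathbf s=(\mathbf y,\mathbf X)$ consists of $\mathbf y\in\mathbb R^k$ and a $k\times q$ matrix $\mathbf X$ with rows $\mathbf x_1^T,\dots,\mathbf x_k^T$; it is identified with the vector $\mathbf s^T=(\mathbf y^T,\mathbf x_1^T,\dots,\mathbf x_k^T)$ in $\mathbb R^k\times\mathbb R^{kq}$. $\mathrm{PDS}(k)$ is the set of positive definite symmetric $k\times k$ matrices; $|\mathbf A|$ is the determinant. $\Theta\subset\mathbb R^l$ and $\mathbf V:\Theta\to\mathrm{PDS}(k)$ is a known map which is identifiable: $\mathbf V(\theta_1)=\mathbf V(\theta_2)$ implies $\theta_1=\theta_2$. Put $\Gamma(\theta)=\mathbf V(\theta)/|\mathbf V(\theta)|^{1/k}$ and $\mathfrak D=\{(\beta,\gamma)\in\mathbb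 R^q\times\Theta:\mathbf V(\gamma)\in\mathrm{PDS}(k),\ |\mathbf V(\gamma)|=1\}$. The "initial functionals" $(\beta_0(P),\theta_0(P))$ are an arbitrary given pair in $\mathbb R^q\times\Theta$. $\mathcal X\subset\mathbb R^{kq}$ is the subset with the lowest dimension $p=\dim(\mathcal X)\le kq$ satisfying $P(\mathbf X\in\mathcal X)=1$. For a unit vector $\alpha\in\mathbb R^{k+kq}$, $\ell\in\mathbb R$, $\delta\ge 0$, the strip is $H(\alpha,\ell,\delta)=\{\mathbf s\in\mathbb R^k\times\mathbb R^{kq}:\ell-\delta/2\le\alpha^T\mathbf s\le\ell+\delta/2\}$.
   Formalization: Added assumption: for every compact set C of positive definite symmetric matrices, {θ in Θ : V(θ) in C} is closed in R^l. Without it a minimizer can be missing, e.g. V(a,b)=diag(a,b) on a,b>0 with the optimal ray a=2b removed from Θ. *)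

theory Defs
  imports "HOL-Analysis.Analysis" "HOL-Probability.Probability"
begin

definition PDS :: "(real ^ 'k ^ 'k) set" where
  "PDS = {A. transpose A = A \<and> (\<forall>x. x \<noteq> 0 \<longrightarrow> x \<bullet> (A *v x) > 0)}"

definition shape :: "('t \<Rightarrow> real ^ 'k ^ 'k) \<Rightarrow> 't \<Rightarrow> real ^ 'k ^ 'k" where
  "shape V \<theta> = (1 / det (V \<theta>) powr (1 / real CARD('k))) *\<^sub>R V \<theta>"

definition unit_det_params ::
  "('t \<Rightarrow> real ^ 'k ^ 'k) \<Rightarrow> 't set \<Rightarrow> ((real ^ 'q) \<times> 't) set" where
  "unit_det_params V \<Theta> = {(\<beta>, \<gamma>). \<gamma> \<in> \<Theta> \<and> V \<gamma> \<in> PDS \<and> det (V \<gamma>) = 1}"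

definition bounded_rho :: "(real \<Rightarrow> real) \<Rightarrow> bool" where
  "bounded_rho \<rho> \<longleftrightarrow>
     (\<forall>u. 0 \<le> \<rho> u) \<and> (\<forall>u. \<rho> (- u) = \<rho> u) \<and> \<rho> 0 = 0 \<and> isCont \<rho> 0 \<and>
     (\<exists>c>0. mono_on {0..c} \<rho> \<and> \<rho> constant_on {c..})"

definition mahalanobis :: "real ^ 'k ^ 'k \<Rightarrow> real ^ 'k \<Rightarrow> real" where
  "mahalanobis A z = sqrt (z \<bullet> (matrix_inv A *v z))"

definition rho_integral ::
  "(real \<Rightarrow> real) \<Rightarrow> ((real ^ 'k) \<times> (real ^ 'q ^ 'k)) measure \<Rightarrow> real \<Rightarrow>
     real ^ 'q \<Rightarrow> real ^ 'k ^ 'k \<Rightarrow> real" where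
  "rho_integral \<rho> P \<sigma> \<beta> A = (LINT s|P. \<rho> (mahalanobis A (fst s - snd s *v \<beta>) / \<sigma>))"

(* A point (y, X) is kept as a pair. The inner product of the product type is
   y . y' + (sum of the inner products of the rows of X and X'), i.e. the Euclidean inner
   product of the stacked vectors (y, x_1, ..., x_k); likewise for norms. *)

definition strip :: "'a::euclidean_space \<Rightarrow> real \<Rightarrow> real \<Rightarrow> 'a set" where
  "strip \<alpha> l \<delta> = {s. l - \<delta> / 2 \<le> \<alpha> \<bullet> s \<and> \<alpha> \<bullet> s \<le> l + \<delta> / 2}"

(* The dimension of a set is that of its affine hull, so that for instance an intercept
   column in X lowers the dimension. *)

definition lowest_dim_carrier ::
  "('a::euclidean_space \<times> 'b::euclidean_space) measure \<Rightarrow> 'b set \<Rightarrow> bool" where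
  "lowest_dim_carrier P \<X> \<longleftrightarrow>
     measure P (UNIV \<times> \<X>) = 1 \<and>
     (\<forall>\<Y>. measure P (UNIV \<times> \<Y>) = 1 \<longrightarrow> aff_dim \<X> \<le> aff_dim \<Y>)"

definition directions :: "'b::euclidean_space set \<Rightarrow> 'b set" where
  "directions \<X> = span {x - x' |x x'. x \<in> \<X> \<and> x' \<in> \<X>}"

(* Strips in UNIV \<times> \<X> have their normal parallel to that set. Without this restriction the
   value is 0 as soon as \<X> lies in a hyperplane, since P is then carried by a strip of
   width 0. If \<X> affinely spans the whole space, every unit vector is admitted. *)

definition min_strip_width ::
  "('a::euclidean_space \<times> 'b::euclidean_space) measure \<Rightarrow> 'b set \<Rightarrow> real \<Rightarrow> real" where
  "min_strip_width P \<X> \<epsilon> =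
     Inf {\<delta>. \<exists>\<alpha> l. measure P (strip \<alpha> l \<delta>) \<ge> \<epsilon> \<and> norm \<alpha> = 1 \<and>
            \<alpha> \<in> UNIV \<times> directions \<X> \<and> \<delta> \<ge> 0}"

end

theory Submission
  imports Defs
begin

text \<open>
  The objective \<open>R(\<beta>, V \<gamma>)\<close> is continuous by dominated convergence, so the only question is whether
  minimization can be confined to a compact set of parameters.

  Only competitors at least as good as the initial value matter. After scaling \<open>V \<theta>\<^sub>0\<close> to determinant
  1, the comparison of \<open>\<rho>\<^sub>1\<close> with \<open>\<rho>\<^sub>0\<close> shows that the initial functionals attain a value of at
  most \<open>r\<^sub>0 sup \<rho>\<^sub>1\<close> (\<open>rho_integral_initial_le\<close>). Since \<open>\<rho>\<^sub>1\<close> equals its supremum beyond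
  \<open>c\<close>, any competitor that is as good leaves at most mass \<open>r\<^sub>0\<close> outside the tube of points whose
  residual has Mahalanobis norm at most \<open>c \<sigma>\<close>. The compact set of mass \<open>r\<^sub>0 + \<epsilon>\<close> therefore meets
  the tube in mass at least \<open>\<epsilon>\<close> (\<open>rho_integral_le_imp_mass\<close>).

  For each unit vector \<open>u\<close> this tube lies in a slab, because
  \<open>(u \<bullet> z)\<^sup>2 \<le> (u \<bullet> A u) (z \<bullet> A\<^sup>-\<^sup>1 z)\<close>. Within \<open>UNIV \<times> \<X>\<close> the slab is a strip with an
  admissible normal: the component of its normal that is orthogonal to the directions of \<open>\<X>\<close> only
  moves the centre. Strips of mass \<open>\<epsilon>\<close> have a minimal positive width, which bounds \<open>u \<bullet> A u\<close> from
  below and the action of \<open>\<beta>\<close> on differences of design matrices from above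
  (\<open>strip_width_bounds\<close>). Together with determinant 1, the lower bound on the quadratic form puts
  \<open>A\<close> in a compact set of positive definite matrices (\<open>compact_unit_det_bounded_below\<close>). One
  observation in the compact set where the fit is close then bounds the fitted values \<open>x \<beta>\<close> for
  all \<open>x\<close> in \<open>\<X>\<close>.

  If \<open>\<X>\<close> is degenerate, \<open>\<beta>\<close> itself need not be bounded. But the objective depends on \<open>\<beta>\<close>
  only through the values \<open>x \<beta>\<close> with \<open>x\<close> in \<open>\<X>\<close>, and \<open>\<beta>\<close> can be replaced by a vector from a
  fixed ball with the same values (\<open>bounded_representative\<close>). All relevant parameters are thus
  represented in a product of a ball and a compact set of \<open>\<gamma>\<close>, where the minimum is attained. The
  vector \<open>\<theta>\<^sub>1\<close> comes from the scaling property, and its uniqueness from identifiability.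
\<close>



section \<open>Positive definite matrices\<close>

lemma PDS_det_nonzero:
  assumes "A \<in> PDS"
  shows "det A \<noteq> 0"
proof -
  have "\<forall>x. A *v x = 0 \<longrightarrow> x = 0"
    using assms by (force simp: PDS_def)
  then show ?thesis
    by (metis invertible_det_nz invertible_left_inverse matrix_left_invertible_ker)
qed

text \<open>
  The determinant has no zero on the segment from the identity to \<open>A\<close>, since positive definiteness
  is preserved along it; hence it keeps the sign that it has at the identity.
\<close>

lemma PDS_det_pos:
  fixes A :: "real ^ 'k ^ 'k"
  assumes A: "A \<in> PDS"
  shows "det A > 0"
proof (rule ccontr)
  assume "\<not> det A > 0"
  define F :: "real \<Rightarrow> real ^ 'k ^ 'k" where "F t = (1 - t) *\<^sub>R mat 1 + t *\<^sub>R A" for t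
  have F_PDS: "F t \<in> PDS" if "0 \<le> t" "t \<le> 1" for t
  proof -
    have "transpose (F t) = F t"
      using A by (simp add: F_def PDS_def transpose_def vec_eq_iff mat_def)
    moreover have "x \<bullet> (F t *v x) > 0" if "x \<noteq> 0" for x
    proof -
      have *: "x \<bullet> (F t *v x) = (1 - t) * (x \<bullet> x) + t * (x \<bullet> (A *v x))"
        by (simp add: F_def matrix_vector_mult_add_rdistrib inner_add_right flip: scaleR_matrix_vector_assoc)
      have "x \<bullet> x > 0" "x \<bullet> (A *v x) > 0"
        using A \<open>x \<noteq> 0\<close> by (auto simp: PDS_def)
      then show ?thesis
        unfolding * using \<open>0 \<le> t\<close> \<open>t \<le> 1\<close>
        by (cases "t = 1") (auto intro!: add_pos_nonneg mult_nonneg_nonneg)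
    qed
    ultimately show ?thesis
      by (simp add: PDS_def)
  qed
  have "continuous_on {0..1} (\<lambda>t. det (F t))"
    unfolding F_def det_def by (intro continuous_intros) 
  moreover have "det (F 1) \<le> 0" "det (F 0) = 1"
    using \<open>\<not> det A > 0\<close> by (auto simp: F_def)
  ultimately obtain t where "0 \<le> t" "t \<le> 1" "det (F t) = 0"
    using IVT2'[of "\<lambda>t. det (F t)" 1 0 0] by auto
  then show False
    using PDS_det_nonzero[OF F_PDS] by blast
qed

lemma matrix_inv_inverse:
  fixes A :: "real ^ 'k ^ 'k"
  assumes "det A \<noteq> 0"
  shows "A ** matrix_inv A = mat 1" "matrix_inv A ** A = mat 1"
proof -
  have "\<exists>B. A ** B = mat 1 \<and> B ** A = mat 1"
    using assms invertible_det_nz[of A] by (simp add: invertible_def)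
  then show "A ** matrix_inv A = mat 1" "matrix_inv A ** A = mat 1"
    unfolding matrix_inv_def by (metis (mono_tags, lifting) someI_ex)+
qed

text \<open>
  Cramer's rule turns the inverse into an explicit expression in the entries. This is how continuity
  of the Mahalanobis norm, jointly in matrix and vector, is obtained.
\<close>

lemma matrix_inv_vector_cramer:
  fixes A :: "real ^ 'k ^ 'k"
  assumes "det A \<noteq> 0"
  shows "matrix_inv A *v z = (\<chi> k. det (\<chi> i j. if j = k then z $ i else A $ i $ j) / det A)"
  using cramer[OF assms, of "matrix_inv A *v z" z] matrix_inv_inverse[OF assms]
  by (simp add: matrix_vector_mul_assoc)

lemma tendsto_det [tendsto_intros]:
  fixes f :: "'a \<Rightarrow> real ^ 'k ^ 'k"
  assumes "(f \<longlongrightarrow> A) F"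
  shows "((\<lambda>x. det (f x)) \<longlongrightarrow> det A) F"
  unfolding det_def by (intro tendsto_intros assms)

lemma tendsto_matrix_vector_mult [tendsto_intros]:
  fixes f :: "'a \<Rightarrow> real ^ 'n ^ 'm"
  assumes "(f \<longlongrightarrow> A) F" "(g \<longlongrightarrow> z) F"
  shows "((\<lambda>x. f x *v g x) \<longlongrightarrow> A *v z) F"
  unfolding matrix_vector_mult_def by (intro tendsto_intros assms)

lemma tendsto_mahalanobis:
  fixes f :: "'a \<Rightarrow> real ^ 'k ^ 'k"
  assumes f: "(f \<longlongrightarrow> A) F" and g: "(g \<longlongrightarrow> z) F" and A: "det A \<noteq> 0"
  shows "((\<lambda>x. mahalanobis (f x) (g x)) \<longlongrightarrow> mahalanobis A z) F"
proof -
  let ?c = "\<lambda>A z. (\<chi> k. det (\<chi> i j. if j = k then z $ i else A $ i $ j) / det A)"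
  have entry: "((\<lambda>x. if c then g x $ i else f x $ i $ j) \<longlongrightarrow> (if c then z $ i else A $ i $ j)) F"
    for c i j using f g by (auto intro: tendsto_intros)
  have "((\<lambda>x. ?c (f x) (g x)) \<longlongrightarrow> ?c A z) F"
    by (intro tendsto_intros entry f A)
  moreover have "\<forall>\<^sub>F x in F. det (f x) \<noteq> 0"
    by (rule tendsto_imp_eventually_ne[OF tendsto_det[OF f] A])
  then have "\<forall>\<^sub>F x in F. ?c (f x) (g x) = matrix_inv (f x) *v g x"
    by eventually_elim (simp add: matrix_inv_vector_cramer)
  ultimately have "((\<lambda>x. matrix_inv (f x) *v g x) \<longlongrightarrow> matrix_inv A *v z) F"
    unfolding matrix_inv_vector_cramer[OF A] by (rule Lim_transform_eventually)
  then show ?thesis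
    unfolding mahalanobis_def by (intro tendsto_real_sqrt tendsto_inner g)
qed

lemma symmetric_matrix_inner_commute:
  fixes A :: "real ^ 'k ^ 'k"
  assumes "transpose A = A"
  shows "x \<bullet> (A *v y) = (A *v x) \<bullet> y"
  by (metis assms dot_lmul_matrix transpose_matrix_vector inner_commute)

lemma PDS_mahalanobis_nonneg:
  assumes "A \<in> PDS"
  shows "z \<bullet> (matrix_inv A *v z) \<ge> 0"
proof -
  let ?w = "matrix_inv A *v z"
  have z: "z = A *v ?w"
    using matrix_inv_inverse(1)[OF PDS_det_nonzero[OF assms]] by (simp add: matrix_vector_mul_assoc)
  have "?w \<bullet> (A *v ?w) \<ge> 0"
    using assms by (cases "?w = 0") (auto simp: PDS_def intro: less_imp_le)
  then show ?thesis
    using z by (metis inner_commute)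
qed

text \<open>
  With \<open>z = A w\<close> this is the Cauchy-Schwarz inequality for the inner product \<open>u \<bullet> A w\<close>. It says that
  a Mahalanobis ball lies between two parallel hyperplanes for every normal \<open>u\<close>.
\<close>

lemma PDS_dual_Cauchy_Schwarz:
  assumes A: "A \<in> PDS"
  shows "\<bar>u \<bullet> z\<bar> \<le> sqrt (u \<bullet> (A *v u)) * mahalanobis A z"
proof -
  define w where "w = matrix_inv A *v z"
  define a where "a = u \<bullet> z"
  define q where "q = z \<bullet> w"
  have z: "z = A *v w"
    using matrix_inv_inverse(1)[OF PDS_det_nonzero[OF A]] by (simp add: matrix_vector_mul_assoc w_def)
  have sym: "transpose A = A"
    using A by (simp add: PDS_def)
  have qf: "x \<bullet> (A *v x) \<ge> 0" for x
    using A by (cases "x = 0") (auto simp: PDS_def intro: less_imp_le)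
  have "a\<^sup>2 \<le> (u \<bullet> (A *v u)) * q"
  proof (cases "w = 0")
    case True
    then show ?thesis by (simp add: a_def q_def z)
  next
    case False
    then have "q > 0"
      using A by (auto simp: q_def z PDS_def inner_commute)
    \<comment> \<open>\<open>q u - a w\<close> is \<open>q\<close> times the component of \<open>u\<close> that is \<open>A\<close>-orthogonal to \<open>w\<close>.\<close>
    have "0 \<le> (q *\<^sub>R u - a *\<^sub>R w) \<bullet> (A *v (q *\<^sub>R u - a *\<^sub>R w))"
      by (rule qf)
    also have "\<dots> = q * (q * (u \<bullet> (A *v u)) - a\<^sup>2)"
      using symmetric_matrix_inner_commute[OF sym, of w u] 
      by (simp add: matrix_vector_mult_diff_distrib matrix_vector_mult_scaleR inner_diff_left
          inner_diff_right a_def q_def z power2_eq_square algebra_simps inner_commute)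
    finally show ?thesis
      using \<open>q > 0\<close> by (simp add: zero_le_mult_iff mult.commute)
  qed
  then have "sqrt (a\<^sup>2) \<le> sqrt (u \<bullet> (A *v u) * q)"
    by (rule real_sqrt_le_mono)
  then show ?thesis
    by (simp add: mahalanobis_def real_sqrt_mult a_def q_def w_def)
qed

section \<open>Compact sets of matrices with determinant 1\<close>

lemma det_bound_entries:
  fixes A :: "real ^ 'k ^ 'k"
  assumes "\<And>i j. \<bar>A $ i $ j\<bar> \<le> h"
  shows "\<bar>det A\<bar> \<le> real (card {p. p permutes (UNIV :: 'k set)}) * h ^ CARD('k)"
proof -
  have "\<bar>det A\<bar> \<le> (\<Sum>p | p permutes (UNIV :: 'k set). \<bar>of_int (sign p) * (\<Prod>i\<in>UNIV. A $ i $ p i)\<bar>)"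
    unfolding det_def by (rule sum_abs)
  also have "\<dots> \<le> (\<Sum>p | p permutes (UNIV :: 'k set). h ^ CARD('k))"
  proof (rule sum_mono)
    fix p :: "'k \<Rightarrow> 'k"
    have "\<bar>of_int (sign p) * (\<Prod>i\<in>UNIV. A $ i $ p i)\<bar> = (\<Prod>i\<in>UNIV. \<bar>A $ i $ p i\<bar>)"
      by (simp add: abs_mult abs_prod sign_def)
    also have "\<dots> \<le> (\<Prod>i\<in>(UNIV::'k set). h)"
      by (intro prod_mono conjI assms abs_ge_zero)
    finally show "\<bar>of_int (sign p) * (\<Prod>i\<in>UNIV. A $ i $ p i)\<bar> \<le> h ^ CARD('k)"
      by simp
  qed
  finally show ?thesis by simp
qed

definition unit_det_bounded_below :: "real \<Rightarrow> (real ^ 'k ^ 'k) set" where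
  "unit_det_bounded_below m =
     {A. transpose A = A \<and> det A = 1 \<and> (\<forall>u. m * (u \<bullet> u) \<le> u \<bullet> (A *v u))}"

text \<open>
  A lower bound on the quadratic form bounds the inverse \<open>G\<close> of \<open>A\<close>. Since \<open>G\<close> has determinant 1 as
  well, the entries of \<open>A = G\<^sup>-\<^sup>1\<close> are the cofactors of \<open>G\<close>, that is, polynomials in its bounded
  entries. This gives the upper bound on \<open>A\<close> without reference to eigenvalues.
\<close>

lemma bounded_unit_det_bounded_below:
  assumes "m > 0"
  shows "bounded (unit_det_bounded_below m :: (real ^ 'k ^ 'k) set)"
proof -
  define h where "h = max 1 (1 / m)"
  define c where "c = real (card {p. p permutes (UNIV :: 'k set)}) * h ^ CARD('k)"
  have "norm A \<le> (\<Sum>i\<in>(UNIV::'k set). \<Sum>j\<in>(UNIV::'k set). c)"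
    if A: "A \<in> unit_det_bounded_below m" for A :: "real ^ 'k ^ 'k"
  proof -
    define G where "G = matrix_inv A"
    have det: "det A = 1" and lower: "m * (u \<bullet> u) \<le> u \<bullet> (A *v u)" for u
      using A by (auto simp: unit_det_bounded_below_def)
    have AG: "A ** G = mat 1" and GA: "G ** A = mat 1"
      using matrix_inv_inverse[of A] det by (auto simp: G_def)
    have "det G = 1"
      using det_mul[of A G] det AG by simp
    have G_le: "norm (G *v z) \<le> norm z / m" for z
    proof -
      let ?w = "G *v z"
      have "m * (norm ?w * norm ?w) \<le> ?w \<bullet> (A *v ?w)"
        using lower[of ?w] by (simp add: dot_square_norm power2_eq_square)
      also have "A *v ?w = z"
        by (simp add: matrix_vector_mul_assoc AG)
      also have "?w \<bullet> z \<le> norm ?w * norm z"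
        by (rule norm_cauchy_schwarz)
      finally have "norm ?w * (m * norm ?w) \<le> norm ?w * norm z"
        by (simp add: algebra_simps)
      then have "m * norm ?w \<le> norm z"
        by (cases "norm ?w = 0") (auto simp: mult_le_cancel_left)
      then show ?thesis
        using assms by (simp add: field_simps)
    qed
    have G_entry: "\<bar>G $ i $ j\<bar> \<le> h" for i j
    proof -
      have "\<bar>G $ i $ j\<bar> = \<bar>(G *v axis j 1) $ i\<bar>"
        by (simp add: matrix_vector_mul_component inner_axis)
      also have "\<dots> \<le> norm (G *v axis j 1)"
        by (rule component_le_norm_cart)
      also have "\<dots> \<le> 1 / m"
        using G_le[of "axis j 1"] by simp
      finally show ?thesis by (simp add: h_def)
    qed
    have A_entry: "\<bar>A $ i $ j\<bar> \<le> c" for i j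
    proof -
      have "G *v (A *v axis j 1) = axis j 1"
        by (simp add: matrix_vector_mul_assoc GA)
      then have "A *v axis j 1 =
          (\<chi> k. det (\<chi> r s. if s = k then axis j (1::real) $ r else G $ r $ s) / det G)"
        using cramer[of G "A *v axis j 1" "axis j 1"] \<open>det G = 1\<close> by simp
      then have "(A *v axis j 1) $ i = det (\<chi> r s. if s = i then axis j (1::real) $ r else G $ r $ s)"
        using \<open>det G = 1\<close> by simp
      moreover have "(A *v axis j 1) $ i = A $ i $ j"
        by (simp add: matrix_vector_mul_component inner_axis)
      moreover have "\<bar>det (\<chi> r s. if s = i then axis j (1::real) $ r else G $ r $ s)\<bar> \<le> c"
        unfolding c_def using G_entry by (intro det_bound_entries) (auto simp: axis_def h_def)
      ultimately show ?thesis by simp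
    qed
    have "norm A \<le> (\<Sum>i\<in>UNIV. norm (A $ i))"
      unfolding norm_vec_def by (rule L2_set_le_sum) simp
    also have "\<dots> \<le> (\<Sum>i\<in>UNIV. \<Sum>j\<in>UNIV. \<bar>A $ i $ j\<bar>)"
      by (intro sum_mono norm_le_l1_cart)
    also have "\<dots> \<le> (\<Sum>i\<in>(UNIV::'k set). \<Sum>j\<in>(UNIV::'k set). c)"
      by (intro sum_mono A_entry)
    finally show ?thesis .
  qed
  then show ?thesis
    by (auto simp: bounded_iff)
qed

lemma compact_unit_det_bounded_below:
  assumes "m > 0"
  shows "compact (unit_det_bounded_below m :: (real ^ 'k ^ 'k) set)"
proof -
  have "closed (unit_det_bounded_below m :: (real ^ 'k ^ 'k) set)"
    unfolding closed_sequential_limits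
  proof (intro allI impI, elim conjE)
    fix f :: "nat \<Rightarrow> real ^ 'k ^ 'k" and A
    assume f: "\<forall>n. f n \<in> unit_det_bounded_below m" and lim: "f \<longlonglongrightarrow> A"
    have "A $ i $ j = A $ j $ i" for i j
    proof -
      have "(\<lambda>n. f n $ i $ j) \<longlonglongrightarrow> A $ i $ j" "(\<lambda>n. f n $ j $ i) \<longlonglongrightarrow> A $ j $ i"
        by (intro tendsto_intros lim)+
      moreover have "f n $ i $ j = f n $ j $ i" for n
        using f by (auto simp: unit_det_bounded_below_def transpose_def vec_eq_iff)
      ultimately show ?thesis
        using LIMSEQ_unique by simp
    qed
    then have "transpose A = A"
      by (simp add: transpose_def vec_eq_iff)
    moreover have "det A = 1"
    proof -
      have "(\<lambda>n. det (f n)) \<longlonglongrightarrow> det A"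
        by (intro tendsto_intros lim)
      moreover have "det (f n) = 1" for n
        using f by (simp add: unit_det_bounded_below_def)
      ultimately show ?thesis
        by (simp add: LIMSEQ_const_iff)
    qed
    moreover have "m * (u \<bullet> u) \<le> u \<bullet> (A *v u)" for u
    proof (rule LIMSEQ_le_const)
      show "(\<lambda>n. u \<bullet> (f n *v u)) \<longlonglongrightarrow> u \<bullet> (A *v u)"
        by (intro tendsto_intros lim)
      show "\<exists>N. \<forall>n\<ge>N. m * (u \<bullet> u) \<le> u \<bullet> (f n *v u)"
        using f by (auto simp: unit_det_bounded_below_def)
    qed
    ultimately show "A \<in> unit_det_bounded_below m"
      by (simp add: unit_det_bounded_below_def)
  qed
  then show ?thesis
    using bounded_unit_det_bounded_below[OF assms] by (simp add: compact_eq_bounded_closed)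
qed

lemma unit_det_bounded_below_subset_PDS:
  assumes "m > 0"
  shows "unit_det_bounded_below m \<subseteq> PDS"
proof
  fix A :: "real ^ 'k ^ 'k"
  assume A: "A \<in> unit_det_bounded_below m"
  have "x \<bullet> (A *v x) > 0" if "x \<noteq> 0" for x
  proof -
    have "0 < m * (x \<bullet> x)" using assms that by simp
    also have "\<dots> \<le> x \<bullet> (A *v x)" using A by (simp add: unit_det_bounded_below_def)
    finally show ?thesis .
  qed
  then show "A \<in> PDS"
    using A by (simp add: PDS_def unit_det_bounded_below_def)
qed

lemma norm_matrix_vector_mult_le:
  fixes A :: "real ^ 'n ^ 'm"
  shows "norm (A *v x) \<le> real CARD('m) * norm A * norm x"
proof -
  have "norm (A *v x) \<le> (\<Sum>i\<in>UNIV. \<bar>(A *v x) $ i\<bar>)"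
    by (rule norm_le_l1_cart)
  also have "\<dots> \<le> (\<Sum>i\<in>(UNIV::'m set). norm A * norm x)"
  proof (rule sum_mono)
    fix i
    have "\<bar>(A *v x) $ i\<bar> \<le> norm (A $ i) * norm x"
      by (simp add: matrix_vector_mul_component Cauchy_Schwarz_ineq2)
    also have "\<dots> \<le> norm A * norm x"
      by (intro mult_right_mono Finite_Cartesian_Product.norm_nth_le norm_ge_zero)
    finally show "\<bar>(A *v x) $ i\<bar> \<le> norm A * norm x" .
  qed
  finally show ?thesis by simp
qed

section \<open>Regression vectors with bounded fitted values\<close>

text \<open>
  Finitely many matrices span all of \<open>\<X>\<close>, so a linear map \<open>S\<close> with their common kernel records
  all values \<open>x \<beta>\<close>. It has a linear right inverse \<open>g\<close> on its range, and \<open>\<beta>' = g (S \<beta>)\<close> is bounded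
  because \<open>S \<beta>\<close> is bounded in terms of the values \<open>x \<beta>\<close>.
\<close>

lemma bounded_representative:
  fixes \<X> :: "(real ^ 'q ^ 'k) set" and b :: "real ^ 'q ^ 'k \<Rightarrow> real"
  obtains M where "\<And>\<beta>. (\<And>x. x \<in> \<X> \<Longrightarrow> norm (x *v \<beta>) \<le> b x) \<Longrightarrow>
    \<exists>\<beta>'. norm \<beta>' \<le> M \<and> (\<forall>x\<in>\<X>. x *v \<beta>' = x *v \<beta>)"
proof -
  obtain B where B: "B \<subseteq> \<X>" "independent B" "\<X> \<subseteq> span B"
    using maximal_independent_subset by blast
  then have "finite B"
    by (simp add: independent_imp_finite)
  \<comment> \<open>The normal-equation operator of the matrices in \<open>B\<close>: its kernel is their common kernel.\<close>
  define S :: "real ^ 'q \<Rightarrow> real ^ 'q" where "S \<beta> = (\<Sum>x\<in>B. transpose x *v (x *v \<beta>))" for \<beta>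
  have linS: "linear S"
    unfolding S_def
    by (intro linearI) (simp_all add: matrix_vector_right_distrib sum.distrib matrix_vector_mult_scaleR scaleR_sum_right)
  obtain g where g: "linear g" "\<And>v. v \<in> range S \<Longrightarrow> S (g v) = v"
    using linear_exists_right_inverse_on[OF linS subspace_UNIV] by auto
  obtain K where K: "\<And>v. norm (g v) \<le> norm v * K" "K > 0"
    using bounded_linear.pos_bounded[OF linear_conv_bounded_linear[THEN iffD1, OF g(1)]] by auto
  define L where "L = (\<Sum>x\<in>B. real CARD('q) * norm (transpose x) * b x)"
  show thesis
  proof (rule that[of "L * K"])
    fix \<beta> assume \<beta>: "\<And>x. x \<in> \<X> \<Longrightarrow> norm (x *v \<beta>) \<le> b x"
    define \<beta>' where "\<beta>' = g (S \<beta>)"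
    have "norm (S \<beta>) \<le> (\<Sum>x\<in>B. norm (transpose x *v (x *v \<beta>)))"
      unfolding S_def by (rule norm_sum)
    also have "\<dots> \<le> L"
      unfolding L_def
    proof (rule sum_mono)
      fix x assume "x \<in> B"
      then have "norm (x *v \<beta>) \<le> b x" using B \<beta> by blast
      have "norm (transpose x *v (x *v \<beta>)) \<le> real CARD('q) * norm (transpose x) * norm (x *v \<beta>)"
        by (rule norm_matrix_vector_mult_le)
      also have "\<dots> \<le> real CARD('q) * norm (transpose x) * b x"
        by (intro mult_left_mono \<open>norm (x *v \<beta>) \<le> b x\<close>) auto
      finally show "norm (transpose x *v (x *v \<beta>)) \<le> real CARD('q) * norm (transpose x) * b x" .
    qed
    finally have "norm \<beta>' \<le> L * K"
      unfolding \<beta>'_def using K(1)[of "S \<beta>"] K(2) by (meson less_imp_le mult_right_mono order_trans)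
    moreover have "S (\<beta>' - \<beta>) = 0"
      using g(2)[of "S \<beta>"] by (simp add: \<beta>'_def linear_diff[OF linS])
    then have "(\<Sum>x\<in>B. (x *v (\<beta>' - \<beta>)) \<bullet> (x *v (\<beta>' - \<beta>))) = 0"
      by (metis (no_types, lifting) S_def dot_lmul_matrix inner_sum_left inner_zero_left sum.cong
          transpose_matrix_vector)
    then have onB: "x *v (\<beta>' - \<beta>) = 0" if "x \<in> B" for x
      using that \<open>finite B\<close> by (subst (asm) sum_nonneg_eq_0_iff) auto
    have "x *v (\<beta>' - \<beta>) = 0" if "x \<in> \<X>" for x
    proof -
      have "x \<in> span B" using that B by blast
      then show ?thesis
        by (induction rule: span_induct_alt)
          (simp_all add: matrix_vector_mult_add_rdistrib onB flip: scaleR_matrix_vector_assoc)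
    qed
    then have "\<forall>x\<in>\<X>. x *v \<beta>' = x *v \<beta>"
      by (simp add: matrix_vector_mult_diff_distrib)
    ultimately show "\<exists>\<beta>'. norm \<beta>' \<le> L * K \<and> (\<forall>x\<in>\<X>. x *v \<beta>' = x *v \<beta>)"
      by blast
  qed
qed



section \<open>The objective function\<close>

lemma bounded_rho_eventually_sup:
  assumes "bounded_rho \<rho>"
  obtains c where "c > 0" "\<And>u. 0 \<le> \<rho> u" "\<And>u. \<rho> u \<le> (SUP v. \<rho> v)"
    "\<And>u. u \<ge> c \<Longrightarrow> \<rho> u = (SUP v. \<rho> v)"
proof -
  obtain c where c: "c > 0" "mono_on {0..c} \<rho>" "\<rho> constant_on {c..}"
    and nonneg: "\<And>u. 0 \<le> \<rho> u" and sym: "\<And>u. \<rho> (- u) = \<rho> u"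
    using assms by (auto simp: bounded_rho_def)
  have const: "\<rho> u = \<rho> c" if "u \<ge> c" for u
    using c(3) that by (auto simp: constant_on_def)
  have le: "\<rho> u \<le> \<rho> c" for u
  proof -
    have "\<rho> \<bar>u\<bar> \<le> \<rho> c"
      using const[of "\<bar>u\<bar>"] c(1) mono_onD[OF c(2), of "\<bar>u\<bar>" c] by (cases "\<bar>u\<bar> \<le> c") auto
    then show ?thesis
      using sym[of u] by (auto simp: abs_if split: if_splits)
  qed
  have "(SUP v. \<rho> v) = \<rho> c"
    by (rule cSup_eq_maximum) (auto simp: le)
  then show thesis
    using const le by (intro that[OF c(1) nonneg]) metis+
qed

lemma borel_measurable_rho_residual:
  fixes P :: "((real ^ 'k) \<times> (real ^ 'q ^ 'k)) measure"
  assumes "sets P = sets borel" "continuous_on UNIV \<rho>" "det A \<noteq> 0" "\<sigma> \<noteq> 0"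
  shows "(\<lambda>s. \<rho> (mahalanobis A (fst s - snd s *v \<beta>) / \<sigma>)) \<in> borel_measurable P"
proof -
  have "continuous_on UNIV (\<lambda>s :: (real ^ 'k) \<times> (real ^ 'q ^ 'k).
      \<rho> (mahalanobis A (fst s - snd s *v \<beta>) / \<sigma>))"
  proof (rule continuous_on_compose2[OF assms(2)])
    show "continuous_on UNIV (\<lambda>s :: (real ^ 'k) \<times> (real ^ 'q ^ 'k).
        mahalanobis A (fst s - snd s *v \<beta>) / \<sigma>)"
      unfolding continuous_on_def
      by (intro ballI tendsto_divide tendsto_mahalanobis tendsto_intros assms)
  qed simp
  then show ?thesis
    using borel_measurable_continuous_onI measurable_cong_sets[OF assms(1) refl] by blast
qed

lemma tendsto_rho_integral:
  fixes P :: "((real ^ 'k) \<times> (real ^ 'q ^ 'k)) measure"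
  assumes P: "prob_space P" "sets P = sets borel"
    and \<rho>: "continuous_on UNIV \<rho>" "\<And>u. 0 \<le> \<rho> u" "\<And>u. \<rho> u \<le> M"
    and \<sigma>: "\<sigma> > 0"
    and lim: "\<beta> \<longlonglongrightarrow> b" "A \<longlonglongrightarrow> a"
    and det: "det a \<noteq> 0" "\<And>n. det (A n) \<noteq> 0"
  shows "(\<lambda>n. rho_integral \<rho> P \<sigma> (\<beta> n) (A n)) \<longlonglongrightarrow> rho_integral \<rho> P \<sigma> b a"
  unfolding rho_integral_def
proof (rule integral_dominated_convergence)
  interpret prob_space P by fact
  show "integrable P (\<lambda>_. M)" by simp
  have "(\<lambda>n. \<rho> (mahalanobis (A n) (fst s - snd s *v \<beta> n) / \<sigma>))
      \<longlonglongrightarrow> \<rho> (mahalanobis a (fst s - snd s *v b) / \<sigma>)" for s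
    using \<sigma> by (intro continuous_on_tendsto_compose[OF \<rho>(1)] tendsto_divide tendsto_mahalanobis
        tendsto_intros lim det) auto
  then show "AE s in P. (\<lambda>n. \<rho> (mahalanobis (A n) (fst s - snd s *v \<beta> n) / \<sigma>))
      \<longlonglongrightarrow> \<rho> (mahalanobis a (fst s - snd s *v b) / \<sigma>)" by simp
  show "AE s in P. norm (\<rho> (mahalanobis (A n) (fst s - snd s *v \<beta> n) / \<sigma>)) \<le> M" for n
    using \<rho> by simp
qed (use P(2) \<rho>(1) \<sigma> det in \<open>simp_all add: borel_measurable_rho_residual\<close>)

lemma rho_integral_cong:
  fixes P :: "((real ^ 'k) \<times> (real ^ 'q ^ 'k)) measure"
  assumes P: "prob_space P" "sets P = sets borel" "measure P (UNIV \<times> \<X>) = 1"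
    and "continuous_on UNIV \<rho>" "\<sigma> > 0" "det A \<noteq> 0"
    and eq: "\<And>x. x \<in> \<X> \<Longrightarrow> x *v \<beta>' = x *v \<beta>"
  shows "rho_integral \<rho> P \<sigma> \<beta>' A = rho_integral \<rho> P \<sigma> \<beta> A"
proof -
  have "AE s in P. s \<in> UNIV \<times> \<X>"
    using prob_space.AE_prob_1[OF P(1) P(3)] .
  then have "AE s in P. \<rho> (mahalanobis A (fst s - snd s *v \<beta>') / \<sigma>) =
      \<rho> (mahalanobis A (fst s - snd s *v \<beta>) / \<sigma>)"
    by eventually_elim (auto simp: eq)
  then show ?thesis
    unfolding rho_integral_def using assms
    by (intro integral_cong_AE borel_measurable_rho_residual) auto
qed

text \<open>
  A Markov-type estimate: \<open>\<rho>\<close> equals its bound \<open>M\<close> on the points with scaled residual at least \<open>c\<close>,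
  so their mass is at most \<open>r\<close>. The remaining part of \<open>K\<close> is fitted well.
\<close>

lemma rho_integral_le_imp_mass:
  fixes P :: "((real ^ 'k) \<times> (real ^ 'q ^ 'k)) measure"
  assumes P: "prob_space P" "sets P = sets borel"
    and \<rho>: "continuous_on UNIV \<rho>" "\<And>u. 0 \<le> \<rho> u" "\<And>u. \<rho> u \<le> M" "\<And>u. u \<ge> c \<Longrightarrow> \<rho> u = M"
    and "M > 0" "\<sigma> > 0" "det A \<noteq> 0"
    and le: "rho_integral \<rho> P \<sigma> \<beta> A \<le> r * M"
    and K: "K \<in> sets P" "measure P K \<ge> r + \<epsilon>"
  obtains F where "F \<subseteq> K" "measure P F \<ge> \<epsilon>" "F \<in> sets P"
    "\<And>s. s \<in> F \<Longrightarrow> mahalanobis A (fst s - snd s *v \<beta>) \<le> c * \<sigma>"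
proof -
  interpret prob_space P by fact
  let ?d = "\<lambda>s. mahalanobis A (fst s - snd s *v \<beta>) / \<sigma>"
  define E where "E = {s. c \<le> ?d s}"
  have d_meas: "?d \<in> borel_measurable P"
    using borel_measurable_rho_residual[OF P(2) continuous_on_id \<open>det A \<noteq> 0\<close>, of \<sigma> \<beta>] \<open>\<sigma> > 0\<close> by simp
  have space: "space P = UNIV"
    using sets_eq_imp_space_eq[OF P(2)] by simp
  have E: "E \<in> sets P"
    using borel_measurable_le[OF borel_measurable_const d_meas] by (simp add: E_def space)
  have "integrable P (\<lambda>s. \<rho> (?d s))"
    using assms by (intro integrable_const_bound[of _ M] borel_measurable_rho_residual) auto
  then have "(LINT s|P. M * indicator E s) \<le> (LINT s|P. \<rho> (?d s))"
    using E \<rho> by (intro integral_mono integrable_mult_right integrable_real_indicator)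
      (auto simp: E_def indicator_def emeasure_eq_measure)
  also have "\<dots> \<le> r * M"
    using le by (simp add: rho_integral_def)
  finally have "M * prob E \<le> M * r"
    using E by (simp add: mult.commute)
  then have "prob E \<le> r"
    using \<open>M > 0\<close> by simp
  moreover have "prob K - prob E \<le> prob (K - E)"
    using finite_measure_Diff'[OF K(1) E] finite_measure_mono[of "K \<inter> E" E] E by simp
  ultimately have "prob (K - E) \<ge> \<epsilon>"
    using K by linarith
  then show thesis
    using E K(1) \<open>\<sigma> > 0\<close> by (intro that[of "K - E"]) (auto simp: E_def field_simps)
qed

section \<open>Bounds from the minimal strip width\<close>

lemma closed_strip: "closed (strip \<alpha> l \<delta>)"
  unfolding strip_def
  by (intro closed_Collect_conj closed_Collect_le continuous_on_inner continuous_on_const continuous_on_id)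

lemma min_strip_width_le:
  assumes "measure P (strip \<alpha> l \<delta>) \<ge> \<epsilon>" "norm \<alpha> = 1" "\<alpha> \<in> UNIV \<times> directions \<X>" "\<delta> \<ge> 0"
  shows "min_strip_width P \<X> \<epsilon> \<le> \<delta>"
  unfolding min_strip_width_def
proof (rule cInf_lower)
  show "bdd_below {\<delta>. \<exists>\<alpha> l. measure P (strip \<alpha> l \<delta>) \<ge> \<epsilon> \<and> norm \<alpha> = 1 \<and>
      \<alpha> \<in> UNIV \<times> directions \<X> \<and> \<delta> \<ge> 0}"
    by (rule bdd_belowI[of _ 0]) auto
qed (use assms in blast)

text \<open>
  For a unit vector \<open>u\<close>, the well-fitted points \<open>s = (y, x)\<close> satisfy
  \<open>\<bar>u \<bullet> (y - x \<beta>)\<bar> \<le> t sqrt (u \<bullet> A u)\<close>. As a function of \<open>s\<close>, the left side is affine with normal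
  \<open>(u, - v)\<close>, where \<open>v\<close> is the outer product of \<open>u\<close> and \<open>\<beta>\<close>. Write \<open>v = p + q\<close> with \<open>p\<close> among the
  directions of \<open>\<X>\<close> and \<open>q\<close> orthogonal to them. Then \<open>q \<bullet> x\<close> is constant on \<open>\<X>\<close>, so these points
  lie in a strip with normal proportional to \<open>(u, - p)\<close>. Its width is
  \<open>2 t sqrt (u \<bullet> A u) / N\<close>, where \<open>N\<close> is the norm of \<open>(u, - p)\<close>. The first bound uses \<open>N \<ge> 1\<close>, the
  second \<open>N \<ge> norm p\<close>.
\<close>

lemma strip_width_bounds:
  fixes P :: "((real ^ 'k) \<times> (real ^ 'q ^ 'k)) measure"
  assumes P: "prob_space P" "sets P = sets borel"
    and A: "A \<in> PDS"
    and F: "F \<subseteq> UNIV \<times> \<X>" "measure P F \<ge> \<epsilon>" "\<epsilon> > 0"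
    and t: "\<forall>s\<in>F. mahalanobis A (fst s - snd s *v \<beta>) \<le> t"
    and u: "norm u = 1"
  shows "min_strip_width P \<X> \<epsilon> \<le> 2 * t * sqrt (u \<bullet> (A *v u))" (is ?A)
    and "x \<in> \<X> \<Longrightarrow> x' \<in> \<X> \<Longrightarrow> min_strip_width P \<X> \<epsilon> > 0 \<Longrightarrow>
      min_strip_width P \<X> \<epsilon> * \<bar>u \<bullet> ((x - x') *v \<beta>)\<bar> \<le> 2 * t * sqrt (u \<bullet> (A *v u)) * norm (x - x')"
      (is "_ \<Longrightarrow> _ \<Longrightarrow> _ \<Longrightarrow> ?B")
proof -
  interpret prob_space P by fact
  let ?\<delta> = "min_strip_width P \<X> \<epsilon>"
  define a where "a = sqrt (u \<bullet> (A *v u))"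
  define v :: "real ^ 'q ^ 'k" where "v = (\<chi> i j. u $ i * \<beta> $ j)"
  have v: "v \<bullet> x = u \<bullet> (x *v \<beta>)" for x
    by (simp add: v_def inner_vec_def matrix_vector_mult_def sum_distrib_left algebra_simps)
  obtain p q where pq: "p \<in> span (directions \<X>)" "\<And>w. w \<in> span (directions \<X>) \<Longrightarrow> orthogonal q w" "v = p + q"
    using orthogonal_subspace_decomp_exists[of "directions \<X>" v] by metis
  have p: "p \<in> directions \<X>"
    using pq(1) unfolding directions_def span_span .
  have q: "q \<bullet> (x - x') = 0" if "x \<in> \<X>" "x' \<in> \<X>" for x x'
    using pq(2)[of "x - x'"] that unfolding directions_def orthogonal_def
    by (blast intro: span_base)
  define N where "N = norm (u, - p)"
  have N2: "N\<^sup>2 = 1 + (norm p)\<^sup>2"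
    using u by (simp add: N_def norm_Pair)
  have N0: "N \<ge> 0"
    by (simp add: N_def)
  have N1: "N \<ge> 1"
    by (rule power2_le_imp_le[OF _ N0]) (simp add: N2)
  have Np: "N \<ge> norm p"
    by (rule power2_le_imp_le[OF _ N0]) (simp add: N2)
  have "F \<noteq> {}"
    using F(2,3) by auto
  then obtain s0 where s0: "s0 \<in> F"
    by blast
  define x0 where "x0 = snd s0"
  have x0: "x0 \<in> \<X>"
    using s0 F(1) by (auto simp: x0_def)
  have a_nonneg: "a \<ge> 0"
    using A by (cases "u = 0") (auto simp: a_def PDS_def intro: less_imp_le)
  have "mahalanobis A z \<ge> 0" for z
    using PDS_mahalanobis_nonneg[OF A] by (simp add: mahalanobis_def)
  then have t0: "t \<ge> 0"
    using t s0 order_trans by blast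
  have "F \<subseteq> strip ((1 / N) *\<^sub>R (u, - p)) ((q \<bullet> x0) / N) (2 * t * a / N)"
  proof
    fix s assume s: "s \<in> F"
    then have "snd s \<in> \<X>" using F(1) by auto
    then have "q \<bullet> snd s = q \<bullet> x0"
      using q[OF _ x0] by (simp add: inner_diff_right)
    then have eq: "(u, - p) \<bullet> s - q \<bullet> x0 = u \<bullet> (fst s - snd s *v \<beta>)"
      using v[of "snd s"] pq(3) by (simp add: inner_prod_def inner_add_left inner_diff_right)
    have "\<bar>u \<bullet> (fst s - snd s *v \<beta>)\<bar> \<le> a * mahalanobis A (fst s - snd s *v \<beta>)"
      unfolding a_def by (rule PDS_dual_Cauchy_Schwarz[OF A])
    also have "\<dots> \<le> a * t"
      using t s by (intro mult_left_mono a_nonneg) auto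
    finally have "\<bar>(u, - p) \<bullet> s - q \<bullet> x0\<bar> \<le> t * a"
      by (simp add: eq mult.commute)
    then have "q \<bullet> x0 - t * a \<le> (u, - p) \<bullet> s" "(u, - p) \<bullet> s \<le> q \<bullet> x0 + t * a"
      by linarith+
    then show "s \<in> strip ((1 / N) *\<^sub>R (u, - p)) ((q \<bullet> x0) / N) (2 * t * a / N)"
      using N1 by (simp add: strip_def divide_right_mono del: scaleR_Pair flip: diff_divide_distrib add_divide_distrib)
  qed
  moreover have "strip ((1 / N) *\<^sub>R (u, - p)) ((q \<bullet> x0) / N) (2 * t * a / N) \<in> sets P"
    unfolding P(2) by (rule borel_closed[OF closed_strip])
  ultimately have "\<epsilon> \<le> measure P (strip ((1 / N) *\<^sub>R (u, - p)) ((q \<bullet> x0) / N) (2 * t * a / N))"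
    using finite_measure_mono[of F] F(2) by (meson order_trans)
  moreover have "norm ((1 / N) *\<^sub>R (u, - p)) = 1"
    using N1 by (simp del: scaleR_Pair flip: N_def)
  moreover have "(1 / N) *\<^sub>R (- p) \<in> directions \<X>"
    using p unfolding directions_def by (intro span_scale span_neg)
  then have "(1 / N) *\<^sub>R (u, - p) \<in> UNIV \<times> directions \<X>"
    by (simp only: scaleR_Pair mem_Times_iff fst_conv snd_conv UNIV_I simp_thms)
  moreover have "2 * t * a / N \<ge> 0"
    using N1 t0 a_nonneg by simp
  ultimately have "?\<delta> \<le> 2 * t * a / N"
    by (rule min_strip_width_le)
  then have \<delta>: "?\<delta> * N \<le> 2 * t * a"
    using N1 by (simp add: field_simps)
  have "2 * t * a / N \<le> 2 * t * a / 1"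
    using N1 t0 a_nonneg by (intro divide_left_mono) auto
  with \<open>?\<delta> \<le> 2 * t * a / N\<close> show ?A
    by (simp add: a_def)
  show ?B if "x \<in> \<X>" "x' \<in> \<X>" "?\<delta> > 0"
  proof -
    have "u \<bullet> ((x - x') *v \<beta>) = p \<bullet> (x - x')"
      using v[of "x - x'"] q[OF that(1,2)] pq(3) by (simp add: inner_add_left)
    then have "\<bar>u \<bullet> ((x - x') *v \<beta>)\<bar> \<le> norm p * norm (x - x')"
      by (simp add: Cauchy_Schwarz_ineq2)
    also have "\<dots> \<le> N * norm (x - x')"
      by (intro mult_right_mono Np) simp
    finally have "?\<delta> * \<bar>u \<bullet> ((x - x') *v \<beta>)\<bar> \<le> ?\<delta> * (N * norm (x - x'))"
      using that(3) by (intro mult_left_mono) auto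
    also have "\<dots> \<le> 2 * t * a * norm (x - x')"
      using mult_right_mono[OF \<delta>, of "norm (x - x')"] by (simp add: mult.assoc)
    finally show ?thesis by (simp add: a_def)
  qed
qed

lemma norm_le_if_unit_inner_le:
  fixes z :: "'a::real_inner"
  assumes "\<And>u. norm u = 1 \<Longrightarrow> \<bar>u \<bullet> z\<bar> \<le> B" "B \<ge> 0"
  shows "norm z \<le> B"
proof (cases "z = 0")
  case False
  then have "\<bar>(z /\<^sub>R norm z) \<bullet> z\<bar> \<le> B"
    by (intro assms) simp
  then show ?thesis
    using False by (simp add: dot_square_norm power2_eq_square flip: mult.assoc)
qed (use assms in simp)

text \<open>
  The order of the bounds matters: the strip width bounds the quadratic form of \<open>A\<close> from below, the determinant then bounds it from above by
  some \<open>a\<^sup>2\<close> on unit vectors, and only then do the strips control \<open>\<beta>\<close>.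
\<close>

lemma concentrated_fit_bounds:
  fixes P :: "((real ^ 'k) \<times> (real ^ 'q ^ 'k)) measure" and \<X> :: "(real ^ 'q ^ 'k) set"
  assumes P: "prob_space P" "sets P = sets borel"
    and K: "compact K" "K \<subseteq> UNIV \<times> \<X>"
    and \<epsilon>: "\<epsilon> > 0" and \<delta>: "min_strip_width P \<X> \<epsilon> > 0" and t: "t > 0"
  obtains m M where "m > 0"
    "\<And>F A \<beta>. F \<subseteq> K \<Longrightarrow> measure P F \<ge> \<epsilon> \<Longrightarrow> A \<in> PDS \<Longrightarrow> det A = 1 \<Longrightarrow>
       (\<forall>s\<in>F. mahalanobis A (fst s - snd s *v \<beta>) \<le> t) \<Longrightarrow>
       A \<in> unit_det_bounded_below m \<and> (\<exists>\<beta>'. norm \<beta>' \<le> M \<and> (\<forall>x\<in>\<X>. x *v \<beta>' = x *v \<beta>))"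
proof -
  let ?\<delta> = "min_strip_width P \<X> \<epsilon>"
  define m where "m = (?\<delta> / (2 * t))\<^sup>2"
  have m: "m > 0" using \<delta> t by (simp add: m_def)
  obtain R where R: "\<And>A. A \<in> unit_det_bounded_below m \<Longrightarrow> norm (A :: real ^ 'k ^ 'k) \<le> R"
    using bounded_unit_det_bounded_below[OF m] by (auto simp: bounded_iff)
  define a where "a = sqrt (real CARD('k) * \<bar>R\<bar>)"
  obtain B where B: "\<And>s. s \<in> K \<Longrightarrow> norm s \<le> B"
    using compact_imp_bounded[OF K(1)] by (auto simp: bounded_iff)
  define b :: "real ^ 'q ^ 'k \<Rightarrow> real"
    where "b x = B + t * a + 2 * t * a / ?\<delta> * (norm x + B)" for x
  obtain M where M: "\<And>\<beta>. (\<And>x. x \<in> \<X> \<Longrightarrow> norm (x *v \<beta>) \<le> b x) \<Longrightarrow>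
      \<exists>\<beta>'. norm \<beta>' \<le> M \<and> (\<forall>x\<in>\<X>. x *v \<beta>' = x *v \<beta>)"
    using bounded_representative[of \<X> b] by metis
  show thesis
  proof (rule that[OF m])
    fix F \<beta> and A :: "real ^ 'k ^ 'k"
    assume F: "F \<subseteq> K" "measure P F \<ge> \<epsilon>" and A: "A \<in> PDS" "det A = 1"
      and fit: "\<forall>s\<in>F. mahalanobis A (fst s - snd s *v \<beta>) \<le> t"
    have FX: "F \<subseteq> UNIV \<times> \<X>" using F K by blast
    note width = strip_width_bounds[OF P A(1) FX F(2) \<epsilon> fit]
    have quad_nonneg: "u \<bullet> (A *v u) \<ge> 0" for u
      using A(1) by (cases "u = 0") (auto simp: PDS_def intro: less_imp_le)
    have unit: "m \<le> u \<bullet> (A *v u)" if "norm u = 1" for u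
    proof -
      have "?\<delta> / (2 * t) \<le> sqrt (u \<bullet> (A *v u))"
        using width(1)[OF that] t by (simp add: field_simps)
      then have "m \<le> (sqrt (u \<bullet> (A *v u)))\<^sup>2"
        unfolding m_def using \<delta> t by (intro power_mono) auto
      then show ?thesis using quad_nonneg by simp
    qed
    have "m * (u \<bullet> u) \<le> u \<bullet> (A *v u)" for u
    proof (cases "u = 0")
      case False
      have "m \<le> (u /\<^sub>R norm u) \<bullet> (A *v (u /\<^sub>R norm u))"
        using False by (intro unit) simp
      also have "\<dots> = (u \<bullet> (A *v u)) / (norm u)\<^sup>2"
        by (simp add: matrix_vector_mult_scaleR power2_eq_square field_simps)
      finally show ?thesis
        using False by (simp add: dot_square_norm field_simps)
    qed simp
    then have AC: "A \<in> unit_det_bounded_below m"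
      using A by (simp add: unit_det_bounded_below_def PDS_def)
    have upper: "sqrt (u \<bullet> (A *v u)) \<le> a" if "norm u = 1" for u
      unfolding a_def
    proof (rule real_sqrt_le_mono)
      have "u \<bullet> (A *v u) \<le> norm (A *v u)"
        using norm_cauchy_schwarz[of u "A *v u"] that by simp
      also have "\<dots> \<le> real CARD('k) * norm A"
        using norm_matrix_vector_mult_le[of A u] that by simp
      also have "\<dots> \<le> real CARD('k) * \<bar>R\<bar>"
        using R[OF AC] by (intro mult_left_mono) auto
      finally show "u \<bullet> (A *v u) \<le> real CARD('k) * \<bar>R\<bar>" .
    qed
    have a0: "a \<ge> 0" by (simp add: a_def)
    have "F \<noteq> {}"
      using F(2) \<epsilon> by auto
    then obtain s where s: "s \<in> F"
      by blast
    obtain y x0 where yx: "s = (y, x0)" by fastforce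
    have x0: "x0 \<in> \<X>" and B': "norm y \<le> B" "norm x0 \<le> B"
      using s FX F(1) B[of s] yx norm_fst_le[of y x0] norm_snd_le[of x0 y]  by auto
    \<comment> \<open>Strips control only \<open>(x - x0) \<beta>\<close>; the well-fitted bounded observation \<open>(y, x0)\<close> adds the
      bound on \<open>x0 \<beta>\<close> itself.\<close>
    have "norm (y - x0 *v \<beta>) \<le> t * a"
    proof (rule norm_le_if_unit_inner_le)
      fix u :: "real ^ 'k" assume u: "norm u = 1"
      have "\<bar>u \<bullet> (y - x0 *v \<beta>)\<bar> \<le> sqrt (u \<bullet> (A *v u)) * mahalanobis A (y - x0 *v \<beta>)"
        by (rule PDS_dual_Cauchy_Schwarz[OF A(1)])
      also have "\<dots> \<le> a * t"
        using bspec[OF fit s] yx upper[OF u] a0 PDS_mahalanobis_nonneg[OF A(1)]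
        by (intro mult_mono) (auto simp: mahalanobis_def)
      finally show "\<bar>u \<bullet> (y - x0 *v \<beta>)\<bar> \<le> t * a" by (simp add: mult.commute)
    qed (use t a0 in simp)
    then have at_x0: "norm (x0 *v \<beta>) \<le> B + t * a"
      using B'(1) norm_triangle_ineq4[of y "y - x0 *v \<beta>"] by simp
    have "norm (x *v \<beta>) \<le> b x" if x: "x \<in> \<X>" for x
    proof -
      have "norm ((x - x0) *v \<beta>) \<le> 2 * t * a / ?\<delta> * norm (x - x0)"
      proof (rule norm_le_if_unit_inner_le)
        fix u :: "real ^ 'k" assume u: "norm u = 1"
        have "?\<delta> * \<bar>u \<bullet> ((x - x0) *v \<beta>)\<bar> \<le> 2 * t * sqrt (u \<bullet> (A *v u)) * norm (x - x0)"
          by (rule width(2)[OF u x x0 \<delta>])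
        also have "\<dots> \<le> 2 * t * a * norm (x - x0)"
          using t upper[OF u] by (intro mult_right_mono mult_left_mono) auto
        finally show "\<bar>u \<bullet> ((x - x0) *v \<beta>)\<bar> \<le> 2 * t * a / ?\<delta> * norm (x - x0)"
          using \<delta> by (simp add: field_simps)
      qed (use t a0 \<delta> in simp)
      also have "\<dots> \<le> 2 * t * a / ?\<delta> * (norm x + B)"
        using t a0 \<delta> B'(2) norm_triangle_ineq4[of x x0] by (intro mult_left_mono) auto
      finally have "norm ((x - x0) *v \<beta>) \<le> 2 * t * a / ?\<delta> * (norm x + B)" .
      moreover have "x *v \<beta> = x0 *v \<beta> + (x - x0) *v \<beta>"
        by (simp add: matrix_vector_mult_diff_rdistrib)
      ultimately show ?thesis
        unfolding b_def using at_x0 norm_triangle_ineq[of "x0 *v \<beta>" "(x - x0) *v \<beta>"] by simp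
    qed
    then show "A \<in> unit_det_bounded_below m \<and> (\<exists>\<beta>'. norm \<beta>' \<le> M \<and> (\<forall>x\<in>\<X>. x *v \<beta>' = x *v \<beta>))"
      using AC M by blast
  qed
qed

section \<open>Existence of a minimizer\<close>

lemma rho_integral_initial_le:
  fixes P :: "((real ^ 'k) \<times> (real ^ 'q ^ 'k)) measure"
  assumes P: "prob_space P" "sets P = sets borel"
    and \<rho>\<^sub>1: "continuous_on UNIV \<rho>\<^sub>1" "\<And>u. 0 \<le> \<rho>\<^sub>1 u" "\<And>u. \<rho>\<^sub>1 u \<le> M\<^sub>1"
    and le: "\<And>u. \<rho>\<^sub>1 u / M\<^sub>1 \<le> \<rho>\<^sub>0 u / M\<^sub>0" and "M\<^sub>1 > 0"
    and "\<sigma> > 0" "det A \<noteq> 0"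
    and b\<^sub>0: "rho_integral \<rho>\<^sub>0 P \<sigma> \<beta> A = b\<^sub>0" "b\<^sub>0 > 0"
  shows "rho_integral \<rho>\<^sub>1 P \<sigma> \<beta> A \<le> b\<^sub>0 / M\<^sub>0 * M\<^sub>1"
proof -
  interpret prob_space P by fact
  let ?d = "\<lambda>s. mahalanobis A (fst s - snd s *v \<beta>) / \<sigma>"
  \<comment> \<open>The integral of a non-integrable function is 0, whereas \<open>b\<^sub>0\<close> is positive.\<close>
  have int0: "integrable P (\<lambda>s. \<rho>\<^sub>0 (?d s))"
    using b\<^sub>0 not_integrable_integral_eq unfolding rho_integral_def by fastforce
  have int1: "integrable P (\<lambda>s. \<rho>\<^sub>1 (?d s))"
    using assms by (intro integrable_const_bound[of _ M\<^sub>1] borel_measurable_rho_residual) auto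
  have "rho_integral \<rho>\<^sub>1 P \<sigma> \<beta> A / M\<^sub>1 = (LINT s|P. \<rho>\<^sub>1 (?d s) / M\<^sub>1)"
    by (simp add: rho_integral_def)
  also have "\<dots> \<le> (LINT s|P. \<rho>\<^sub>0 (?d s) / M\<^sub>0)"
    using int0 int1 le by (intro integral_mono integrable_divide) auto
  also have "\<dots> = b\<^sub>0 / M\<^sub>0"
    using b\<^sub>0(1) by (simp add: rho_integral_def)
  finally show ?thesis
    using \<open>M\<^sub>1 > 0\<close> by (simp add: divide_le_eq)
qed

lemma unit_det_shape_parameter:
  fixes V :: "'t \<Rightarrow> real ^ 'k ^ 'k"
  assumes V: "V \<theta> \<in> PDS"
    and scale: "\<And>\<alpha>. \<alpha> > 0 \<Longrightarrow> \<exists>\<theta>'\<in>\<Theta>. \<alpha> *\<^sub>R V \<theta> = V \<theta>'"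
  obtains \<gamma> where "\<gamma> \<in> \<Theta>" "V \<gamma> = shape V \<theta>" "det (V \<gamma>) = 1"
proof -
  let ?d = "det (V \<theta>)"
  have d: "?d > 0" using PDS_det_pos[OF V] .
  define \<alpha> where "\<alpha> = 1 / ?d powr (1 / real CARD('k))"
  have "\<alpha> > 0" using d by (simp add: \<alpha>_def)
  then obtain \<gamma> where \<gamma>: "\<gamma> \<in> \<Theta>" "V \<gamma> = \<alpha> *\<^sub>R V \<theta>"
    using scale by metis
  have "det (V \<gamma>) = \<alpha> ^ CARD('k) * ?d"
  proof -
    have "\<alpha> *\<^sub>R V \<theta> = matrix ((*\<^sub>R) \<alpha>) ** V \<theta>"
      by (simp add: matrix_eq matrix_works flip: matrix_vector_mul_assoc scaleR_matrix_vector_assoc)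
    then show ?thesis
      by (simp add: \<gamma> det_mul)
  qed
  also have "\<dots> = 1"
    using d by (simp add: \<alpha>_def power_divide powr_powr flip: powr_realpow)
  finally show thesis
    using that \<gamma> by (simp add: \<alpha>_def shape_def)
qed

lemma rho_integral_attains_inf_on_compact:
  fixes P :: "((real ^ 'k) \<times> (real ^ 'q ^ 'k)) measure" and V :: "real ^ 'l \<Rightarrow> real ^ 'k ^ 'k"
  assumes P: "prob_space P" "sets P = sets borel"
    and \<rho>: "continuous_on UNIV \<rho>" "\<And>u. 0 \<le> \<rho> u" "\<And>u. \<rho> u \<le> M"
    and \<sigma>: "\<sigma> > 0"
    and S: "compact S" "S \<noteq> {}"
    and V: "continuous_on (snd ` S) V" "\<And>s. s \<in> S \<Longrightarrow> det (V (snd s)) \<noteq> 0"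
  obtains \<beta> \<gamma> where "(\<beta>, \<gamma>) \<in> S"
    "\<And>\<beta>' \<gamma>'. (\<beta>', \<gamma>') \<in> S \<Longrightarrow> rho_integral \<rho> P \<sigma> \<beta> (V \<gamma>) \<le> rho_integral \<rho> P \<sigma> \<beta>' (V \<gamma>')"
proof -
  have "continuous_on S (\<lambda>s. rho_integral \<rho> P \<sigma> (fst s) (V (snd s)))"
    unfolding continuous_on_sequentially o_def
  proof (intro ballI allI impI, elim conjE)
    fix f a assume a: "a \<in> S" and f: "\<forall>n. f n \<in> S" "f \<longlonglongrightarrow> a"
    have "(\<lambda>n. V (snd (f n))) \<longlonglongrightarrow> V (snd a)"
      using a f by (intro continuous_on_tendsto_compose[OF V(1)] tendsto_intros) auto
    then show "(\<lambda>n. rho_integral \<rho> P \<sigma> (fst (f n)) (V (snd (f n))))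
        \<longlonglongrightarrow> rho_integral \<rho> P \<sigma> (fst a) (V (snd a))"
      using a f by (intro tendsto_rho_integral[OF P \<rho> \<sigma>] tendsto_fst V(2)) auto
  qed
  then obtain s where "s \<in> S"
    "\<forall>s'\<in>S. rho_integral \<rho> P \<sigma> (fst s) (V (snd s)) \<le> rho_integral \<rho> P \<sigma> (fst s') (V (snd s'))"
    using continuous_attains_inf[OF S] by blast
  then show thesis
    by (intro that[of "fst s" "snd s"]) auto
qed

theorem theorem1:
  fixes V :: "real ^ 'l \<Rightarrow> real ^ 'k ^ 'k"
    and \<Theta> :: "(real ^ 'l) set"
    and P :: "((real ^ 'k) \<times> (real ^ 'q ^ 'k)) measure"
    and \<X> :: "(real ^ 'q ^ 'k) set"
    and \<rho>\<^sub>0 \<rho>\<^sub>1 :: "real \<Rightarrow> real"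
    and b\<^sub>0 r\<^sub>0 \<epsilon> \<sigma> :: real
    and \<beta>\<^sub>0 :: "real ^ 'q" and \<theta>\<^sub>0 :: "real ^ 'l"
  assumes V_PDS: "V \<in> \<Theta> \<rightarrow> PDS"
    and V_identifiable: "inj_on V \<Theta>"
    and rho0: "bounded_rho \<rho>\<^sub>0"
    and rho1: "bounded_rho \<rho>\<^sub>1"
    and rho_le: "\<And>u. \<rho>\<^sub>1 u / (SUP v. \<rho>\<^sub>1 v) \<le> \<rho>\<^sub>0 u / (SUP v. \<rho>\<^sub>0 v)"
    and rho1_cont: "continuous_on UNIV \<rho>\<^sub>1"
    and b0: "0 < b\<^sub>0" "b\<^sub>0 < (SUP v. \<rho>\<^sub>0 v)"
    and r0: "r\<^sub>0 = b\<^sub>0 / (SUP v. \<rho>\<^sub>0 v)"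
    and V_cont: "continuous_on \<Theta> V"
    and V_id: "\<exists>\<theta>\<in>\<Theta>. V \<theta> = mat 1"
    and V_scale: "\<And>\<theta> \<alpha>. \<theta> \<in> \<Theta> \<Longrightarrow> \<alpha> > 0 \<Longrightarrow> \<exists>\<theta>'\<in>\<Theta>. \<alpha> *\<^sub>R V \<theta> = V \<theta>'"
    and V_bounded: "\<And>B. bounded B \<Longrightarrow> bounded {\<theta> \<in> \<Theta>. V \<theta> \<in> B}"
    and V_closed: "\<And>C. compact C \<Longrightarrow> C \<subseteq> PDS \<Longrightarrow> closed {\<theta> \<in> \<Theta>. V \<theta> \<in> C}"
    and P: "prob_space P" "sets P = sets borel"
    and X: "lowest_dim_carrier P \<X>"
    and eps: "0 < \<epsilon>" "\<epsilon> \<le> 1 - r\<^sub>0"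
    and K: "\<exists>K. compact K \<and> K \<subseteq> UNIV \<times> \<X> \<and> measure P K \<ge> r\<^sub>0 + \<epsilon>"
    and strips: "min_strip_width P \<X> \<epsilon> > 0"
    and theta0: "\<theta>\<^sub>0 \<in> \<Theta>"
    and sigma: "\<sigma> > 0" "rho_integral \<rho>\<^sub>0 P \<sigma> \<beta>\<^sub>0 (shape V \<theta>\<^sub>0) = b\<^sub>0"
  shows "\<exists>\<beta>\<^sub>1 \<gamma>. (\<beta>\<^sub>1, \<gamma>) \<in> unit_det_params V \<Theta> \<and>
           (\<forall>(\<beta>, \<gamma>') \<in> unit_det_params V \<Theta>.
              rho_integral \<rho>\<^sub>1 P \<sigma> \<beta>\<^sub>1 (V \<gamma>) \<le> rho_integral \<rho>\<^sub>1 P \<sigma> \<beta> (V \<gamma>')) \<and>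
           (\<exists>!\<theta>\<^sub>1. \<theta>\<^sub>1 \<in> \<Theta> \<and> V \<theta>\<^sub>1 = \<sigma>\<^sup>2 *\<^sub>R V \<gamma>)"
proof -
  define M\<^sub>1 where "M\<^sub>1 = (SUP v. \<rho>\<^sub>1 v)"
  obtain c where c: "c > 0" "\<And>u. 0 \<le> \<rho>\<^sub>1 u" "\<And>u. \<rho>\<^sub>1 u \<le> M\<^sub>1" "\<And>u. u \<ge> c \<Longrightarrow> \<rho>\<^sub>1 u = M\<^sub>1"
    using bounded_rho_eventually_sup[OF rho1] unfolding M\<^sub>1_def by metis
  have V_mem: "V \<theta> \<in> PDS" if "\<theta> \<in> \<Theta>" for \<theta>
    using V_PDS that by blast
  obtain \<gamma>\<^sub>0 where \<gamma>\<^sub>0: "\<gamma>\<^sub>0 \<in> \<Theta>" "V \<gamma>\<^sub>0 = shape V \<theta>\<^sub>0" "det (V \<gamma>\<^sub>0) = 1"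
    using unit_det_shape_parameter[OF V_mem[OF theta0] V_scale[OF theta0]] by blast
  have param0: "(\<beta>\<^sub>0, \<gamma>\<^sub>0) \<in> unit_det_params V \<Theta>"
    using \<gamma>\<^sub>0 V_mem[OF \<gamma>\<^sub>0(1)] by (simp add: unit_det_params_def)
  let ?R = "\<lambda>\<beta> \<gamma>. rho_integral \<rho>\<^sub>1 P \<sigma> \<beta> (V \<gamma>)"
  have "\<exists>\<beta>\<^sub>1 \<gamma>. (\<beta>\<^sub>1, \<gamma>) \<in> unit_det_params V \<Theta> \<and>
      (\<forall>(\<beta>, \<gamma>') \<in> unit_det_params V \<Theta>. ?R \<beta>\<^sub>1 \<gamma> \<le> ?R \<beta> \<gamma>')"
  proof (cases "M\<^sub>1 > 0")
    case False
    \<comment> \<open>Here \<open>\<rho>\<^sub>1\<close> vanishes identically and every admissible pair is a minimizer.\<close>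
    then have "\<rho>\<^sub>1 u = 0" for u
      using c(2,3)[of u] by linarith
    then show ?thesis
      using param0 by (auto simp: rho_integral_def)
  next
    case True
    have R0: "?R \<beta>\<^sub>0 \<gamma>\<^sub>0 \<le> r\<^sub>0 * M\<^sub>1"
      unfolding \<gamma>\<^sub>0(2) r0
    proof (rule rho_integral_initial_le[OF P rho1_cont c(2,3) _ True sigma(1) _ sigma(2) b0(1)])
      show "\<rho>\<^sub>1 u / M\<^sub>1 \<le> \<rho>\<^sub>0 u / (SUP v. \<rho>\<^sub>0 v)" for u
        using rho_le unfolding M\<^sub>1_def .
      show "det (shape V \<theta>\<^sub>0) \<noteq> 0"
        using \<gamma>\<^sub>0 by simp
    qed
    obtain K where K: "compact K" "K \<subseteq> UNIV \<times> \<X>" "measure P K \<ge> r\<^sub>0 + \<epsilon>"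
      using K by blast
    have K_sets: "K \<in> sets P"
      unfolding P(2) by (rule borel_compact[OF K(1)])
    have carrier: "measure P (UNIV \<times> \<X>) = 1"
      using X by (simp add: lowest_dim_carrier_def)
    have t: "c * \<sigma> > 0"
      using c(1) sigma(1) by simp
    obtain m B where m: "m > 0" and bounds:
      "\<And>F A \<beta>. F \<subseteq> K \<Longrightarrow> measure P F \<ge> \<epsilon> \<Longrightarrow> A \<in> PDS \<Longrightarrow> det A = 1 \<Longrightarrow>
         (\<forall>s\<in>F. mahalanobis A (fst s - snd s *v \<beta>) \<le> c * \<sigma>) \<Longrightarrow>
         A \<in> unit_det_bounded_below m \<and> (\<exists>\<beta>'. norm \<beta>' \<le> B \<and> (\<forall>x\<in>\<X>. x *v \<beta>' = x *v \<beta>))"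
      using concentrated_fit_bounds[OF P K(1,2) eps(1) strips t] by metis
    define T where "T = {\<theta> \<in> \<Theta>. V \<theta> \<in> unit_det_bounded_below m}"
    define S where "S = cball (0 :: real ^ 'q) B \<times> T"
    have "compact T"
      unfolding T_def compact_eq_bounded_closed
      using V_bounded V_closed bounded_unit_det_bounded_below[OF m]
        compact_unit_det_bounded_below[OF m] unit_det_bounded_below_subset_PDS[OF m] by blast
    then have "compact S"
      unfolding S_def by (intro compact_Times compact_cball)
    have T_param: "(\<beta>, \<gamma>) \<in> unit_det_params V \<Theta>" if "\<gamma> \<in> T" for \<beta> :: "real ^ 'q" and \<gamma>
      using that V_mem by (auto simp: T_def unit_det_bounded_below_def unit_det_params_def)
    \<comment> \<open>Every competitor as good as the start has an equivalent one in the compact set \<open>S\<close>.\<close>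
    have reduce: "\<exists>\<beta>'. (\<beta>', \<gamma>) \<in> S \<and> ?R \<beta>' \<gamma> = ?R \<beta> \<gamma>"
      if param: "(\<beta>, \<gamma>) \<in> unit_det_params V \<Theta>" and le: "?R \<beta> \<gamma> \<le> ?R \<beta>\<^sub>0 \<gamma>\<^sub>0" for \<beta> \<gamma>
    proof -
      have \<gamma>: "\<gamma> \<in> \<Theta>" "V \<gamma> \<in> PDS" "det (V \<gamma>) = 1"
        using param by (auto simp: unit_det_params_def)
      have det: "det (V \<gamma>) \<noteq> 0"
        using \<gamma> by simp
      have "?R \<beta> \<gamma> \<le> r\<^sub>0 * M\<^sub>1"
        using le R0 by linarith
      then obtain F where F: "F \<subseteq> K" "measure P F \<ge> \<epsilon>"
        "\<forall>s\<in>F. mahalanobis (V \<gamma>) (fst s - snd s *v \<beta>) \<le> c * \<sigma>"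
        using rho_integral_le_imp_mass[OF P rho1_cont c(2-4) True sigma(1) det _ K_sets K(3)] by metis
      have "V \<gamma> \<in> unit_det_bounded_below m"
        and "\<exists>\<beta>'. norm \<beta>' \<le> B \<and> (\<forall>x\<in>\<X>. x *v \<beta>' = x *v \<beta>)"
        using bounds[OF F(1,2) \<gamma>(2,3) F(3)] by auto
      then obtain \<beta>' where \<beta>': "norm \<beta>' \<le> B" "\<And>x. x \<in> \<X> \<Longrightarrow> x *v \<beta>' = x *v \<beta>" and "\<gamma> \<in> T"
        using \<gamma> by (auto simp: T_def)
      have "?R \<beta>' \<gamma> = ?R \<beta> \<gamma>"
        by (rule rho_integral_cong[OF P carrier rho1_cont sigma(1) det \<beta>'(2)])
      then show ?thesis
        using \<beta>'(1) \<open>\<gamma> \<in> T\<close> by (auto simp: S_def)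
    qed
    obtain \<beta>\<^sub>0' where start: "(\<beta>\<^sub>0', \<gamma>\<^sub>0) \<in> S" "?R \<beta>\<^sub>0' \<gamma>\<^sub>0 = ?R \<beta>\<^sub>0 \<gamma>\<^sub>0"
      using reduce[OF param0 order_refl] by blast
    have "continuous_on (snd ` S) V"
      by (rule continuous_on_subset[OF V_cont]) (auto simp: S_def T_def)
    moreover have "det (V (snd s)) \<noteq> 0" if "s \<in> S" for s
      using that by (auto simp: S_def T_def unit_det_bounded_below_def)
    ultimately obtain \<beta>\<^sub>1 \<gamma> where min: "(\<beta>\<^sub>1, \<gamma>) \<in> S"
      "\<And>\<beta>' \<gamma>'. (\<beta>', \<gamma>') \<in> S \<Longrightarrow> ?R \<beta>\<^sub>1 \<gamma> \<le> ?R \<beta>' \<gamma>'"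
      using rho_integral_attains_inf_on_compact[OF P rho1_cont c(2,3) sigma(1) \<open>compact S\<close>, of V]
        start(1) by blast
    have "?R \<beta>\<^sub>1 \<gamma> \<le> ?R \<beta> \<gamma>'" if param: "(\<beta>, \<gamma>') \<in> unit_det_params V \<Theta>" for \<beta> \<gamma>'
    proof (cases "?R \<beta> \<gamma>' \<le> ?R \<beta>\<^sub>0 \<gamma>\<^sub>0")
      case True
      then obtain \<beta>' where "(\<beta>', \<gamma>') \<in> S" "?R \<beta>' \<gamma>' = ?R \<beta> \<gamma>'"
        using reduce[OF param] by blast
      then show ?thesis
        using min(2) by metis
    next
      case False
      then show ?thesis
        using min(2)[OF start(1)] start(2) by linarith
    qed
    moreover have "(\<beta>\<^sub>1, \<gamma>) \<in> unit_det_params V \<Theta>"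
      using min(1) by (intro T_param) (simp add: S_def)
    ultimately show ?thesis
      by blast
  qed
  then obtain \<beta>\<^sub>1 \<gamma> where \<gamma>: "(\<beta>\<^sub>1, \<gamma>) \<in> unit_det_params V \<Theta>"
    "\<forall>(\<beta>, \<gamma>') \<in> unit_det_params V \<Theta>. ?R \<beta>\<^sub>1 \<gamma> \<le> ?R \<beta> \<gamma>'"
    by blast
  have "\<gamma> \<in> \<Theta>"
    using \<gamma>(1) by (simp add: unit_det_params_def)
  then obtain \<theta>\<^sub>1 where "\<theta>\<^sub>1 \<in> \<Theta>" "\<sigma>\<^sup>2 *\<^sub>R V \<gamma> = V \<theta>\<^sub>1"
    using V_scale[of \<gamma> "\<sigma>\<^sup>2"] sigma(1) by auto
  then have "\<exists>!\<theta>\<^sub>1. \<theta>\<^sub>1 \<in> \<Theta> \<and> V \<theta>\<^sub>1 = \<sigma>\<^sup>2 *\<^sub>R V \<gamma>"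
    using V_identifiable by (auto simp: inj_on_def)
  then show ?thesis
    using \<gamma> by blast
qed

end
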